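(* Let $E$ be a regular $(a,b)$-module and suppose there are two decompositions into direct sums of sub-$(a,b)$-modules $$E=\bigoplus_{i=1}^m E_i,\qquad E=\bigoplus_{i=1}^n F_i,$$ where $m,n\in\mathbb{N}$ and all $E_i$ and $F_i$ are nonzero indecomposable $(a,b)$-modules. Then $m=n$ and, up to a reindexing of the modules, $E_i$ is isomorphic to $F_i$ as an $(a,b)$-module for all $1\le i\le n$.
   Context: An $(a,b)$-module is a free $\mathbb{C}[[b]]$-module $E$ of finite rank with a $\mathbb{C}$-linear map $a:E\to E$ such that $ab-ba=b^2$, where $b$ also denotes multiplication by $b$. A morphism of $(a,b)$-modules is a $\mathbb{C}[[b]]$-linear map commuting with $a$; an isomorphism is a bijective morphism. A sub-$(a,b)$-module is a $\mathbb{C}[[b]]$-submodule stable under $a$. $E$ is a simple-pole $(a,b)$-module if $aE\subset bE$, and $E$ is regular if it is (isomorphic to) a sub-$(a,b)$-module of a simple-pole $(a,b)$-module. $E$ is indecomposable if it cannot be written as a direct sum $F\oplus G$ of nonzero $(a,b)$-modules. *)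

theory Defs
  imports
    "HOL-Computational_Algebra.Formal_Power_Series"
    "HOL-Library.FuncSet"
    "HOL-Library.Function_Algebras"
begin

text \<open>
  The formal variable b is \<^const>\<open>fps_X\<close>, and modules are subsets E of an ambient
  module over the ring of complex power series, so that the sub-(a,b)-modules of E are
  modules of the same kind. The operator a is only relevant on E.
\<close>

locale ab_module = module scale
  for scale :: "complex fps \<Rightarrow> 'e::ab_group_add \<Rightarrow> 'e" +
  fixes E :: "'e set" and a :: "'e \<Rightarrow> 'e"
  assumes free_finite_rank: "\<exists>B. finite B \<and> independent B \<and> span B = E"
    and a_closed: "x \<in> E \<Longrightarrow> a x \<in> E"
    and a_add: "x \<in> E \<Longrightarrow> y \<in> E \<Longrightarrow> a (x + y) = a x + a y"
    and a_scale_const: "x \<in> E \<Longrightarrow> a (scale (fps_const z) x) = scale (fps_const z) (a x)"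
    and commutator: "x \<in> E \<Longrightarrow>
      a (scale fps_X x) - scale fps_X (a x) = scale fps_X (scale fps_X x)"

text \<open>
  Freeness of a submodule is not required separately: the ring of power series is a principal
  ideal domain, so submodules of free modules of finite rank are again free of finite rank.
\<close>

definition sub_ab_module ::
  "(complex fps \<Rightarrow> 'e::ab_group_add \<Rightarrow> 'e) \<Rightarrow> 'e set \<Rightarrow> ('e \<Rightarrow> 'e) \<Rightarrow> 'e set \<Rightarrow> bool" where
  "sub_ab_module scale E a F \<longleftrightarrow> module.subspace scale F \<and> F \<subseteq> E \<and> a ` F \<subseteq> F"

definition ab_morphism ::
  "(complex fps \<Rightarrow> 'e::ab_group_add \<Rightarrow> 'e) \<Rightarrow> 'e set \<Rightarrow> ('e \<Rightarrow> 'e) \<Rightarrow>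
   (complex fps \<Rightarrow> 'f::ab_group_add \<Rightarrow> 'f) \<Rightarrow> 'f set \<Rightarrow> ('f \<Rightarrow> 'f) \<Rightarrow> ('e \<Rightarrow> 'f) \<Rightarrow> bool" where
  "ab_morphism s E a t F c \<phi> \<longleftrightarrow>
     \<phi> \<in> E \<rightarrow> F \<and>
     (\<forall>x\<in>E. \<forall>y\<in>E. \<phi> (x + y) = \<phi> x + \<phi> y) \<and>
     (\<forall>r. \<forall>x\<in>E. \<phi> (s r x) = t r (\<phi> x)) \<and>
     (\<forall>x\<in>E. \<phi> (a x) = c (\<phi> x))"

definition ab_isomorphic ::
  "(complex fps \<Rightarrow> 'e::ab_group_add \<Rightarrow> 'e) \<Rightarrow> 'e set \<Rightarrow> ('e \<Rightarrow> 'e) \<Rightarrow>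
   (complex fps \<Rightarrow> 'f::ab_group_add \<Rightarrow> 'f) \<Rightarrow> 'f set \<Rightarrow> ('f \<Rightarrow> 'f) \<Rightarrow> bool" where
  "ab_isomorphic s E a t F c \<longleftrightarrow> (\<exists>\<phi>. ab_morphism s E a t F c \<phi> \<and> bij_betw \<phi> E F)"

definition simple_pole ::
  "(complex fps \<Rightarrow> 'e::ab_group_add \<Rightarrow> 'e) \<Rightarrow> 'e set \<Rightarrow> ('e \<Rightarrow> 'e) \<Rightarrow> bool" where
  "simple_pole scale E a \<longleftrightarrow> ab_module scale E a \<and> a ` E \<subseteq> scale fps_X ` E"

definition coord_scale :: "complex fps \<Rightarrow> (nat \<Rightarrow> complex fps) \<Rightarrow> nat \<Rightarrow> complex fps" where
  "coord_scale r f = (\<lambda>i. r * f i)"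

text \<open>
  One cannot quantify over the type carrying the simple-pole module, so it is taken inside the
  fixed module of sequences of power series, which contains a copy of every free module of finite
  rank. The lemma \<open>regularI\<close> below shows that this is no restriction: a simple-pole
  module over any type will do.
\<close>

definition regular ::
  "(complex fps \<Rightarrow> 'e::ab_group_add \<Rightarrow> 'e) \<Rightarrow> 'e set \<Rightarrow> ('e \<Rightarrow> 'e) \<Rightarrow> bool" where
  "regular scale E a \<longleftrightarrow> ab_module scale E a \<and>
     (\<exists>F c G. simple_pole coord_scale F c \<and> sub_ab_module coord_scale F c G \<and>
        ab_isomorphic scale E a coord_scale G c)"

definition direct_sum :: "'e::ab_group_add set \<Rightarrow> 'i set \<Rightarrow> ('i \<Rightarrow> 'e set) \<Rightarrow> bool" where
  "direct_sum E I Es \<longleftrightarrow> bij_betw (\<lambda>f. \<Sum>i\<in>I. f i) (\<Pi>\<^sub>E i\<in>I. Es i) E"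

definition direct_sum2 :: "'e::ab_group_add set \<Rightarrow> 'e set \<Rightarrow> 'e set \<Rightarrow> bool" where
  "direct_sum2 E F G \<longleftrightarrow> bij_betw (\<lambda>(x, y). x + y) (F \<times> G) E"

definition indecomposable ::
  "(complex fps \<Rightarrow> 'e::ab_group_add \<Rightarrow> 'e) \<Rightarrow> 'e set \<Rightarrow> ('e \<Rightarrow> 'e) \<Rightarrow> bool" where
  "indecomposable scale E a \<longleftrightarrow>
     \<not> (\<exists>F G. sub_ab_module scale E a F \<and> sub_ab_module scale E a G \<and>
            F \<noteq> {0} \<and> G \<noteq> {0} \<and> direct_sum2 E F G)"

lemma module_coord_scale: "module coord_scale"
  by standard (auto simp: coord_scale_def fun_eq_iff algebra_simps)

lemma ab_module_transport:
  fixes s :: "complex fps \<Rightarrow> 'e::ab_group_add \<Rightarrow> 'e"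
    and t :: "complex fps \<Rightarrow> 'f::ab_group_add \<Rightarrow> 'f"
  assumes E: "ab_module s E a" and t: "module t"
    and add: "\<And>x y. x \<in> E \<Longrightarrow> y \<in> E \<Longrightarrow> \<phi> (x + y) = \<phi> x + \<phi> y"
    and scl: "\<And>r x. x \<in> E \<Longrightarrow> \<phi> (s r x) = t r (\<phi> x)"
    and inj: "inj_on \<phi> E"
  defines "c \<equiv> \<lambda>y. \<phi> (a (inv_into E \<phi> y))"
  shows "ab_module t (\<phi> ` E) c" and "\<And>x. x \<in> E \<Longrightarrow> c (\<phi> x) = \<phi> (a x)"
proof -
  interpret E: ab_module s E a by fact
  interpret t: module t by fact
  show c: "\<And>x. x \<in> E \<Longrightarrow> c (\<phi> x) = \<phi> (a x)"
    by (simp add: c_def inj)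
  obtain B where B: "finite B" "E.independent B" "E.span B = E"
    using E.free_finite_rank by blast
  have BE: "B \<subseteq> E" using B(3) E.span_superset by blast
  have sE: "E.subspace E" using B(3) E.subspace_span by metis
  have zero: "\<phi> 0 = 0" using add[of 0 0] E.subspace_0[OF sE] by simp
  have injB: "inj_on \<phi> B" using inj BE inj_on_subset by blast
  have comb: "\<phi> (\<Sum>b\<in>A. s (u b) b) = (\<Sum>b\<in>A. t (u b) (\<phi> b))" if "A \<subseteq> B" for A u
    using finite_subset[OF that B(1)] that
  proof (induction A)
    case empty
    then show ?case by (simp add: zero)
  next
    case (insert x A)
    have "s (u x) x \<in> E" "(\<Sum>b\<in>A. s (u b) b) \<in> E"
      using insert BE by (auto intro!: E.subspace_scale[OF sE] E.subspace_sum[OF sE])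
    then show ?case using insert BE by (auto simp: add scl)
  qed
  have reindex: "(\<Sum>w\<in>\<phi> ` B. t (u w) w) = \<phi> (\<Sum>b\<in>B. s (u (\<phi> b)) b)" for u
    by (simp add: sum.reindex[OF injB] comb)
  have inE: "(\<Sum>b\<in>B. s (u b) b) \<in> E" for u
    using BE by (auto intro!: E.subspace_scale[OF sE] E.subspace_sum[OF sE])
  have "t.independent (\<phi> ` B)"
  proof -
    have "u (\<phi> b) = 0" if "(\<Sum>w\<in>\<phi> ` B. t (u w) w) = 0" "b \<in> B" for u b
    proof -
      have "\<phi> (\<Sum>b\<in>B. s (u (\<phi> b)) b) = \<phi> 0" using that(1) by (simp only: reindex zero)
      then have "(\<Sum>b\<in>B. s (u (\<phi> b)) b) = 0"
        by (rule inj_onD[OF inj _ inE E.subspace_0[OF sE]])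
      then show ?thesis
        using E.independentD[OF B(2,1) order_refl, of "\<lambda>b. u (\<phi> b)"] that(2) by simp
    qed
    then show ?thesis unfolding t.dependent_finite[OF finite_imageI[OF B(1)]] by blast
  qed
  moreover have "t.span (\<phi> ` B) = \<phi> ` E"
  proof
    show "t.span (\<phi> ` B) \<subseteq> \<phi> ` E"
      unfolding t.span_finite[OF finite_imageI[OF B(1)]] using inE by (auto simp: reindex)
    show "\<phi> ` E \<subseteq> t.span (\<phi> ` B)"
    proof
      fix y assume "y \<in> \<phi> ` E"
      then obtain u where y: "y = \<phi> (\<Sum>b\<in>B. s (u b) b)"
        using B(3) E.span_finite[OF B(1)] by auto
      show "y \<in> t.span (\<phi> ` B)"
        unfolding y comb[OF order_refl] by (intro t.span_sum t.span_scale t.span_base imageI)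
    qed
  qed
  ultimately have free: "\<exists>B. finite B \<and> t.independent B \<and> t.span B = \<phi> ` E"
    using B(1) by blast
  note cl = E.subspace_add[OF sE] E.subspace_scale[OF sE] E.a_closed
  show "ab_module t (\<phi> ` E) c"
  proof
    show "\<exists>B. finite B \<and> t.independent B \<and> t.span B = \<phi> ` E" by (rule free)
  next
    fix y assume "y \<in> \<phi> ` E"
    then show "c y \<in> \<phi> ` E" by (auto simp: c cl)
  next
    fix x y assume "x \<in> \<phi> ` E" "y \<in> \<phi> ` E"
    then show "c (x + y) = c x + c y"
      by (auto simp: c cl E.a_add simp flip: add)
  next
    fix y z assume "y \<in> \<phi> ` E"
    then show "c (t (fps_const z) y) = t (fps_const z) (c y)"
      by (auto simp: c cl E.a_scale_const simp flip: scl)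
  next
    fix y assume "y \<in> \<phi> ` E"
    then obtain x where x: "x \<in> E" "y = \<phi> x" by blast
    have "a (s fps_X x) = s fps_X (a x) + s fps_X (s fps_X x)"
      using E.commutator[OF x(1)] by (simp add: algebra_simps)
    then have "\<phi> (a (s fps_X x)) = t fps_X (\<phi> (a x)) + t fps_X (t fps_X (\<phi> x))"
      using x(1) cl by (simp add: add scl del: E.scale_scale t.scale_scale)
    then show "c (t fps_X y) - t fps_X (c y) = t fps_X (t fps_X y)"
      using x cl by (simp add: c del: t.scale_scale flip: scl)
  qed
qed

lemma regularI:
  fixes s :: "complex fps \<Rightarrow> 'e::ab_group_add \<Rightarrow> 'e"
    and t :: "complex fps \<Rightarrow> 'f::ab_group_add \<Rightarrow> 'f"
  assumes E: "ab_module s E a" and F: "simple_pole t F c"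
    and G: "sub_ab_module t F c G" and iso: "ab_isomorphic s E a t G c"
  shows "regular s E a"
proof -
  interpret F: ab_module t F c using F by (simp add: simple_pole_def)
  interpret k: module coord_scale by (rule module_coord_scale)
  obtain B where B: "finite B" "F.independent B" "F.span B = F"
    using F.free_finite_rank by blast
  have sF: "F.subspace F" using B(3) F.subspace_span by metis
  obtain \<beta> where \<beta>: "bij_betw \<beta> {0..<card B} B"
    using ex_bij_betw_nat_finite[OF B(1)] by blast
  define \<phi> where
    "\<phi> x = (\<lambda>i. if i < card B then F.representation B x (\<beta> i) else 0)" for x
  have add: "\<phi> (x + y) = \<phi> x + \<phi> y" if "x \<in> F" "y \<in> F" for x y
    using that by (auto simp: \<phi>_def fun_eq_iff F.representation_add B)
  have scl: "\<phi> (t r x) = coord_scale r (\<phi> x)" if "x \<in> F" for r x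
    using that by (auto simp: \<phi>_def fun_eq_iff F.representation_scale B coord_scale_def)
  have inj: "inj_on \<phi> F"
  proof (rule inj_onI)
    fix x y assume xy: "x \<in> F" "y \<in> F" "\<phi> x = \<phi> y"
    have "F.representation B x b = F.representation B y b" if b: "b \<in> B" for b
    proof -
      have "b \<in> \<beta> ` {0..<card B}" using \<beta> b by (simp add: bij_betw_def)
      then obtain i where "i < card B" "b = \<beta> i" by auto
      then show ?thesis using fun_cong[OF xy(3), of i] by (simp add: \<phi>_def)
    qed
    then have "(\<Sum>b\<in>B. t (F.representation B x b) b) = (\<Sum>b\<in>B. t (F.representation B y b) b)"
      by simp
    moreover have "(\<Sum>b\<in>B. t (F.representation B v b) b) = v" if "v \<in> F" for v
      by (rule F.sum_representation_eq) (use B that in auto)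
    ultimately show "x = y" using xy(1,2) by simp
  qed
  define d where "d = (\<lambda>y. \<phi> (c (inv_into F \<phi> y)))"
  have M: "ab_module coord_scale (\<phi> ` F) d" and d: "\<And>x. x \<in> F \<Longrightarrow> d (\<phi> x) = \<phi> (c x)"
    using ab_module_transport[OF F.ab_module_axioms module_coord_scale add scl inj]
    by (auto simp: d_def)
  have "d ` \<phi> ` F \<subseteq> coord_scale fps_X ` \<phi> ` F"
  proof clarify
    fix x assume x: "x \<in> F"
    then obtain y where "y \<in> F" "c x = t fps_X y"
      using F by (auto simp: simple_pole_def)
    then show "d (\<phi> x) \<in> coord_scale fps_X ` \<phi> ` F" using x by (auto simp: d scl)
  qed
  with M have sp: "simple_pole coord_scale (\<phi> ` F) d" by (simp add: simple_pole_def)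
  have G': "F.subspace G" "G \<subseteq> F" "c ` G \<subseteq> G" using G by (auto simp: sub_ab_module_def)
  then have GF: "x \<in> F" if "x \<in> G" for x using that by blast
  have zero: "\<phi> 0 = 0" using add[of 0 0] F.subspace_0[OF sF] by simp
  have "k.subspace (\<phi> ` G)"
  proof (rule k.subspaceI)
    show "0 \<in> \<phi> ` G" by (rule image_eqI[where x = 0]) (use zero F.subspace_0[OF G'(1)] in auto)
  next
    fix x y assume "x \<in> \<phi> ` G" "y \<in> \<phi> ` G"
    then obtain x' y' where "x' \<in> G" "y' \<in> G" "x = \<phi> x'" "y = \<phi> y'" by blast
    then have "x + y = \<phi> (x' + y')" "x' + y' \<in> G"
      using F.subspace_add[OF G'(1)] by (auto simp: add GF)
    then show "x + y \<in> \<phi> ` G" by (rule image_eqI)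
  next
    fix r x assume "x \<in> \<phi> ` G"
    then obtain x' where "x' \<in> G" "x = \<phi> x'" by blast
    then have "coord_scale r x = \<phi> (t r x')" "t r x' \<in> G"
      using F.subspace_scale[OF G'(1)] by (auto simp: scl GF)
    then show "coord_scale r x \<in> \<phi> ` G" by (rule image_eqI)
  qed
  moreover have "d ` \<phi> ` G \<subseteq> \<phi> ` G" using G'(2,3) d by (auto simp: subset_iff)
  ultimately have sub: "sub_ab_module coord_scale (\<phi> ` F) d (\<phi> ` G)"
    using G'(2) by (auto simp: sub_ab_module_def)
  obtain \<psi> where \<psi>: "ab_morphism s E a t G c \<psi>" "bij_betw \<psi> E G"
    using iso by (auto simp: ab_isomorphic_def)
  have "bij_betw (\<phi> \<circ> \<psi>) E (\<phi> ` G)"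
    by (rule bij_betw_trans[OF \<psi>(2) inj_on_imp_bij_betw[OF inj_on_subset[OF inj G'(2)]]])
  moreover have "ab_morphism s E a coord_scale (\<phi> ` G) d (\<phi> \<circ> \<psi>)"
  proof -
    have \<psi>F: "\<psi> x \<in> G" "\<psi> x \<in> F" if "x \<in> E" for x
      using that \<psi>(1) G'(2) by (auto simp: ab_morphism_def)
    then show ?thesis using \<psi>(1) by (auto simp: ab_morphism_def add scl d)
  qed
  ultimately have "ab_isomorphic s E a coord_scale (\<phi> ` G) d"
    by (auto simp: ab_isomorphic_def)
  with E sp sub show ?thesis by (auto simp: regular_def)
qed

end

theory Submission
  imports Defs "HOL-Computational_Algebra.Polynomial_Factorial"
    "HOL-Computational_Algebra.Field_as_Ring"
begin

text \<open>
  The endomorphism ring of an indecomposable summand M of E is local, and then the exchange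
  argument of Krull, Schmidt and Azumaya applies. For the locality, reduction modulo b shows that
  an endomorphism f is annihilated modulo b by a polynomial \<open>t^N Q(t)\<close> with complex
  coefficients and \<open>Q(0) \<noteq> 0\<close>. Since E is b-adically complete, the polynomials in f
  that separate \<open>t^(N k)\<close> from \<open>Q^k\<close> converge to an idempotent commuting with a.
  On M it is 0 or 1, so f is either nilpotent modulo b or invertible; as \<open>t^N\<close> and
  \<open>(1 - t)^N'\<close> are coprime, f and 1 - f cannot both be nilpotent modulo b.
\<close>

text \<open>When E is nonzero, the submodules b^k E descend strictly for ever, so Fitting's lemma
  cannot be drawn from a descending chain condition. Each E / b^k E is finite-dimensional over the
  complex numbers, and there a polynomial in f gives the splitting. The task is to choose these
  polynomials compatibly in k; congruences modulo the powers of one polynomial P with P(f) = 0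
  modulo b achieve this. Two facts shape the construction. Multiplication by b does not commute with
  a, so the polynomials need complex coefficients, and P is only known to annihilate f modulo b.
  Also a is not linear over power series, so passing to the limit needs that a preserves every b^k
  E. Summands are never turned into modules of their own: an endomorphism of M = p E is an
  endomorphism f of E with p f = f = f p. Thus one filtration and one completeness statement serve
  all summands.\<close>

unbundle fps_syntax

lemma sum_fun_apply:
  fixes f :: "'i \<Rightarrow> 'a \<Rightarrow> 'b::comm_monoid_add"
  shows "(\<Sum>i\<in>I. f i) x = (\<Sum>i\<in>I. f i x)"
  by (induction I rule: infinite_finite_induct) auto

context ab_module
begin

lemma subspace_E: "subspace E"
  using free_finite_rank subspace_span by metis

lemmas E_zero [simp] = subspace_0[OF subspace_E]
  and E_add [simp] = subspace_add[OF subspace_E]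
  and E_scale [simp] = subspace_scale[OF subspace_E]
  and E_diff [simp] = subspace_diff[OF subspace_E]
  and E_sum = subspace_sum[OF subspace_E]

declare a_closed [simp]

lemma a_zero: "a 0 = 0"
  using a_add[of 0 0] by simp

lemma a_diff: "x \<in> E \<Longrightarrow> y \<in> E \<Longrightarrow> a (x - y) = a x - a y"
  using a_add[of "x - y" y] by (simp add: algebra_simps)

section \<open>Endomorphisms of E\<close>

abbreviation endo :: "('e \<Rightarrow> 'e) \<Rightarrow> bool" where
  "endo f \<equiv> ab_morphism scale E a scale E a f"

lemma endoI:
  assumes "\<And>x. x \<in> E \<Longrightarrow> f x \<in> E"
    and "\<And>x y. x \<in> E \<Longrightarrow> y \<in> E \<Longrightarrow> f (x + y) = f x + f y"
    and "\<And>r x. x \<in> E \<Longrightarrow> f (scale r x) = scale r (f x)"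
    and "\<And>x. x \<in> E \<Longrightarrow> f (a x) = a (f x)"
  shows "endo f"
  using assms by (auto simp: ab_morphism_def)

lemma
  assumes "endo f"
  shows endo_closed: "x \<in> E \<Longrightarrow> f x \<in> E"
    and endo_add: "x \<in> E \<Longrightarrow> y \<in> E \<Longrightarrow> f (x + y) = f x + f y"
    and endo_scale: "x \<in> E \<Longrightarrow> f (scale r x) = scale r (f x)"
    and endo_a: "x \<in> E \<Longrightarrow> f (a x) = a (f x)"
  using assms by (auto simp: ab_morphism_def)

lemma endo_0: "endo f \<Longrightarrow> f 0 = 0"
  using endo_add[of f 0 0] by simp

lemma endo_diff: "endo f \<Longrightarrow> x \<in> E \<Longrightarrow> y \<in> E \<Longrightarrow> f (x - y) = f x - f y"
  using endo_add[of f "x - y" y] by (simp add: algebra_simps)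

lemma endo_neg: "endo f \<Longrightarrow> x \<in> E \<Longrightarrow> f (- x) = - f x"
  using endo_diff[of f 0 x] by (simp add: endo_0)

lemma endo_sum_arg:
  assumes "endo f" "\<And>i. i \<in> I \<Longrightarrow> g i \<in> E"
  shows "f (\<Sum>i\<in>I. g i) = (\<Sum>i\<in>I. f (g i))"
  using assms(2) by (induction I rule: infinite_finite_induct)
    (auto simp: endo_0 endo_add E_sum assms(1))

lemma endo_comp: "endo f \<Longrightarrow> endo g \<Longrightarrow> endo (\<lambda>x. f (g x))"
  by (rule endoI) (auto simp: endo_closed endo_add endo_scale endo_a)

lemma endo_plus: "endo f \<Longrightarrow> endo g \<Longrightarrow> endo (\<lambda>x. f x + g x)"
  by (rule endoI) (auto simp: endo_closed endo_add endo_scale endo_a a_add algebra_simps)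

lemma endo_minus: "endo f \<Longrightarrow> endo g \<Longrightarrow> endo (\<lambda>x. f x - g x)"
  by (rule endoI) (auto simp: endo_closed endo_add endo_scale endo_a a_diff algebra_simps)

lemma endo_id: "endo (\<lambda>x. x)"
  by (rule endoI) auto

lemma endo_null: "endo (\<lambda>x. 0)"
  by (rule endoI) (auto simp: a_zero)

lemma endo_sum: "(\<And>i. i \<in> I \<Longrightarrow> endo (f i)) \<Longrightarrow> endo (\<lambda>x. \<Sum>i\<in>I. f i x)"
  by (induction I rule: infinite_finite_induct) (auto simp: endo_null endo_plus)

lemma endo_const: "endo (scale (fps_const c))"
  by (rule endoI) (auto simp: a_scale_const algebra_simps)

lemma funpow_closed: "endo f \<Longrightarrow> x \<in> E \<Longrightarrow> (f ^^ n) x \<in> E"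
  by (induction n) (auto simp: endo_closed)

section \<open>The b-adic filtration: separation and completeness\<close>

definition adic :: "nat \<Rightarrow> 'e set" where
  "adic k = scale (fps_X ^ k) ` E"

lemma adic_subset: "x \<in> adic k \<Longrightarrow> x \<in> E"
  by (auto simp: adic_def)

lemma adic_0: "adic 0 = E"
  by (auto simp: adic_def)

lemma adicI: "y \<in> E \<Longrightarrow> x = scale (fps_X ^ k) y \<Longrightarrow> x \<in> adic k"
  by (auto simp: adic_def)

lemma adicE:
  assumes "x \<in> adic k"
  obtains y where "y \<in> E" "x = scale (fps_X ^ k) y"
  using assms by (auto simp: adic_def)

lemma subspace_adic: "subspace (adic k)"
proof (rule subspaceI)
  show "0 \<in> adic k" by (rule adicI[of 0]) auto
  show "x + y \<in> adic k" if "x \<in> adic k" "y \<in> adic k" for x y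
    using that by (auto elim!: adicE intro!: adicI[of "_ + _"] simp: algebra_simps)
  show "scale r x \<in> adic k" if "x \<in> adic k" for r x
    using that
    by (auto elim!: adicE intro!: adicI[of "scale r _"] simp: mult.commute)
qed

lemmas adic_zero = subspace_0[OF subspace_adic]
  and adic_add = subspace_add[OF subspace_adic]
  and adic_diff = subspace_diff[OF subspace_adic]
  and adic_scale = subspace_scale[OF subspace_adic]
  and adic_sum = subspace_sum[OF subspace_adic]

lemma adic_scale_X: "x \<in> adic k \<Longrightarrow> scale fps_X x \<in> adic (Suc k)"
  by (auto elim!: adicE intro!: adicI)

lemma adic_Suc_subset: "x \<in> adic (Suc k) \<Longrightarrow> x \<in> adic k"
  by (auto elim!: adicE intro!: adicI[of "scale fps_X _"] simp: mult.commute)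

lemma adic_antimono: "k \<le> l \<Longrightarrow> x \<in> adic l \<Longrightarrow> x \<in> adic k"
  by (induction l rule: dec_induct) (auto dest: adic_Suc_subset)

lemma endo_adic: "endo f \<Longrightarrow> x \<in> adic k \<Longrightarrow> f x \<in> adic k"
  by (auto elim!: adicE intro!: adicI[of "f _"] simp: endo_closed endo_scale)

text \<open>Linearity over power series makes orders of vanishing add up under composition. Hence a
  polynomial that annihilates f modulo b has powers that annihilate f modulo the powers of
  b.\<close>

lemma endo_adic_add:
  assumes "endo f" "\<And>x. x \<in> E \<Longrightarrow> f x \<in> adic j" "x \<in> adic k"
  shows "f x \<in> adic (j + k)"
proof -
  from assms(3) obtain y where y: "y \<in> E" "x = scale (fps_X ^ k) y" by (rule adicE)
  from assms(2)[OF y(1)] obtain z where "z \<in> E" "f y = scale (fps_X ^ j) z" by (rule adicE)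
  then have "f x = scale (fps_X ^ (j + k)) z"
    using y by (simp add: endo_scale[OF assms(1)] power_add mult.commute)
  with \<open>z \<in> E\<close> show ?thesis by (rule adicI)
qed

text \<open>Not a matter of linearity, since a does not commute with b: the commutator relation
  gives a(bz) = b(az) + b(bz), and both terms are one step deeper in the filtration than z.\<close>

lemma a_adic: "x \<in> adic k \<Longrightarrow> a x \<in> adic k"
proof (induction k arbitrary: x)
  case 0
  then show ?case by (simp add: adic_0)
next
  case (Suc k)
  then obtain y where y: "y \<in> E" "x = scale (fps_X ^ Suc k) y" by (elim adicE)
  define z where "z = scale (fps_X ^ k) y"
  have z: "z \<in> adic k" using y(1) by (auto simp: z_def intro: adicI)
  have "x = scale fps_X z" by (simp add: z_def y)
  then have "a x = scale fps_X (a z) + scale fps_X (scale fps_X z)"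
    using commutator[of z] adic_subset[OF z] by (simp add: algebra_simps)
  then show ?case
    using adic_add[OF adic_scale_X[OF Suc.IH[OF z]] adic_scale[OF adic_scale_X[OF z]]] by simp
qed

text \<open>Freeness reduces divisibility by b^k to the vanishing of the first k coefficients of
  each coordinate. One basis serves all k, so separation and completeness become statements about
  coefficients of power series.\<close>

lemma basis_coordinates:
  obtains B where "finite B" "B \<subseteq> E" "independent B" "span B = E"
    "\<And>k x. x \<in> adic k \<longleftrightarrow> x \<in> E \<and> (\<forall>v\<in>B. \<forall>n<k. representation B x v $ n = 0)"
proof -
  obtain B where B: "finite B" "independent B" "span B = E"
    using free_finite_rank by blast
  have BE: "B \<subseteq> E" using B(3) span_superset by blast
  have "x \<in> adic k \<longleftrightarrow> x \<in> E \<and> (\<forall>v\<in>B. \<forall>n<k. representation B x v $ n = 0)" for k x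
  proof (intro iffI conjI ballI allI impI)
    assume x: "x \<in> E \<and> (\<forall>v\<in>B. \<forall>n<k. representation B x v $ n = 0)"
    define y where "y = (\<Sum>v\<in>B. scale (fps_shift k (representation B x v)) v)"
    have "fps_X ^ k * fps_shift k (representation B x v) = representation B x v" if "v \<in> B" for v
      using x that by (auto simp: fps_eq_iff fps_X_power_mult_nth)
    then have "scale (fps_X ^ k) y = (\<Sum>v\<in>B. scale (representation B x v) v)"
      by (simp add: y_def scale_sum_right)
    also have "\<dots> = x" by (rule sum_representation_eq) (use B x in auto)
    finally show "x \<in> adic k"
      using BE by (intro adicI[of y]) (auto simp: y_def intro!: E_sum)
  qed (auto elim!: adicE simp: representation_scale B fps_X_power_mult_nth)
  with B BE show ?thesis by (intro that)
qed

lemma adic_separated: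
  assumes "\<And>k. x \<in> adic k"
  shows "x = 0"
proof -
  obtain B where B: "finite B" "B \<subseteq> E" "independent B" "span B = E"
    "\<And>k x. x \<in> adic k \<longleftrightarrow> x \<in> E \<and> (\<forall>v\<in>B. \<forall>n<k. representation B x v $ n = 0)"
    by (rule basis_coordinates) blast
  have "representation B x v = 0" if "v \<in> B" for v
    using assms that B(5) by (auto simp: fps_eq_iff)
  moreover have "(\<Sum>v\<in>B. scale (representation B x v) v) = x"
    by (rule sum_representation_eq) (use B adic_subset[OF assms] in auto)
  ultimately show ?thesis by simp
qed

lemma adic_complete:
  assumes E: "\<And>k. x k \<in> E" and Cauchy: "\<And>k. x (Suc k) - x k \<in> adic k"
  obtains y where "y \<in> E" "\<And>k. y - x k \<in> adic k"
proof -
  obtain B where B: "finite B" "B \<subseteq> E" "independent B" "span B = E"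
    and adic: "\<And>k x. x \<in> adic k \<longleftrightarrow> x \<in> E \<and> (\<forall>v\<in>B. \<forall>n<k. representation B x v $ n = 0)"
    by (rule basis_coordinates) blast
  have diff: "x l - x k \<in> adic k" if "k \<le> l" for k l
    using that
  proof (induction l rule: dec_induct)
    case base
    then show ?case by (simp add: adic_zero)
  next
    case (step l)
    have "x (Suc l) - x l \<in> adic k"
      by (rule adic_antimono[OF _ Cauchy]) (use step in simp)
    from adic_add[OF this step.IH] show ?case by simp
  qed
  \<comment> \<open>Modulo \<open>adic (Suc n)\<close> the sequence is constant from
    \<open>x (Suc n)\<close> on, so this term already carries the final coefficient of index n;
    \<open>x n\<close> fixes only the coefficients below n.\<close>
  define c where "c v = Abs_fps (\<lambda>n. representation B (x (Suc n)) v $ n)" for v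
  define y where "y = (\<Sum>v\<in>B. scale (c v) v)"
  have yE: "y \<in> E" using B(2) by (auto simp: y_def intro!: E_sum)
  have rep_y: "representation B y v = c v" if v: "v \<in> B" for v
  proof -
    have "representation B y v = (\<Sum>w\<in>B. representation B (scale (c w) w) v)"
      unfolding y_def by (subst representation_sum) (use B in \<open>simp_all add: subset_iff\<close>)
    also have "\<dots> = (\<Sum>w\<in>B. if w = v then c v else 0)"
      by (rule sum.cong)
        (use B in \<open>simp_all add: representation_scale representation_basis subset_iff\<close>)
    also have "\<dots> = c v" using B(1) v by simp
    finally show ?thesis .
  qed
  have "y - x k \<in> adic k" for k
    unfolding adic
  proof (intro conjI ballI allI impI)
    show "y - x k \<in> E" using yE E by simp
    fix v n assume v: "v \<in> B" and n: "n < k"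
    have "x k - x (Suc n) \<in> adic (Suc n)" using n by (intro diff) simp
    then have "representation B (x k - x (Suc n)) v $ n = 0"
      using v adic by blast
    then show "representation B (y - x k) v $ n = 0"
      using E yE B v by (simp add: representation_diff rep_y c_def)
  qed
  with yE show ?thesis by (rule that)
qed

section \<open>Polynomials in an endomorphism and their b-adic limits\<close>

definition pev :: "('e \<Rightarrow> 'e) \<Rightarrow> complex poly \<Rightarrow> 'e \<Rightarrow> 'e" where
  "pev f p x = fold_coeffs (\<lambda>c y. scale (fps_const c) x + f y) p 0"

lemma pev_0 [simp]: "pev f 0 x = 0"
  by (simp add: pev_def)

lemma pev_pCons: "endo f \<Longrightarrow> pev f (pCons c p) x = scale (fps_const c) x + f (pev f p x)"
  by (cases "p = 0 \<and> c = 0") (auto simp: pev_def endo_0)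

lemma pev_endo:
  assumes f: "endo f"
  shows "endo (pev f p)"
proof (induction p)
  case 0
  have "pev f 0 = (\<lambda>x. 0)" by (rule ext) simp
  then show ?case by (simp only: endo_null)
next
  case (pCons c p)
  have "pev f (pCons c p) = (\<lambda>x. scale (fps_const c) x + f (pev f p x))"
    by (rule ext) (rule pev_pCons[OF f])
  then show ?case by (simp only: endo_plus endo_const endo_comp f pCons)
qed

lemma pev_closed: "endo f \<Longrightarrow> x \<in> E \<Longrightarrow> pev f p x \<in> E"
  using pev_endo endo_closed by blast

lemma pev_add: "endo f \<Longrightarrow> x \<in> E \<Longrightarrow> pev f (p + q) x = pev f p x + pev f q x"
  by (induction p q rule: poly_induct2)
    (simp_all add: pev_pCons endo_add pev_closed algebra_simps flip: fps_const_add)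

lemma pev_smult: "endo f \<Longrightarrow> x \<in> E \<Longrightarrow> pev f (smult c p) x = scale (fps_const c) (pev f p x)"
  by (induction p) (simp_all add: pev_pCons endo_scale pev_closed algebra_simps)

lemma pev_diff: "endo f \<Longrightarrow> x \<in> E \<Longrightarrow> pev f (p - q) x = pev f p x - pev f q x"
  using pev_add[of f x "p - q" q] by (simp add: algebra_simps)

lemma pev_mult: "endo f \<Longrightarrow> x \<in> E \<Longrightarrow> pev f (p * q) x = pev f p (pev f q x)"
  by (induction p) (simp_all add: pev_pCons pev_add pev_smult)

lemma pev_1: "endo f \<Longrightarrow> pev f 1 x = x"
  by (simp add: one_pCons pev_pCons endo_0)

lemma pev_var: "endo f \<Longrightarrow> pev f [:0, 1:] x = f x"
  by (simp add: pev_pCons endo_0)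

lemma pev_var_power: "endo f \<Longrightarrow> x \<in> E \<Longrightarrow> pev f ([:0, 1:] ^ n) x = (f ^^ n) x"
  by (induction n) (simp_all only: power_0 power_Suc pev_1 pev_mult pev_var funpow.simps id_apply comp_apply)

lemma pev_commute:
  assumes "endo f" "endo g" "\<And>x. x \<in> E \<Longrightarrow> g (f x) = f (g x)" "x \<in> E"
  shows "g (pev f p x) = pev f p (g x)"
  by (induction p)
    (simp_all add: assms pev_pCons endo_0 endo_add endo_scale endo_closed pev_closed)

lemma pev_adic_power:
  assumes "endo f" "\<And>x. x \<in> E \<Longrightarrow> pev f P x \<in> adic 1" "x \<in> E"
  shows "pev f (P ^ k) x \<in> adic k"
proof (induction k)
  case 0
  then show ?case by (simp add: pev_1 assms adic_0)
next
  case (Suc k)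
  from endo_adic_add[OF pev_endo[OF assms(1)] assms(2) Suc] assms(1,3)
  show ?case by (simp add: pev_mult)
qed

lemma pev_adic_dvd:
  assumes "endo f" "\<And>x. x \<in> E \<Longrightarrow> pev f P x \<in> adic 1" "x \<in> E" "P ^ k dvd p"
  shows "pev f p x \<in> adic k"
proof -
  obtain q where "p = P ^ k * q" using assms(4) by (elim dvdE)
  with pev_adic_power[OF assms(1,2) pev_closed[OF assms(1,3)]] assms(1,3)
  show ?thesis by (simp add: pev_mult)
qed

lemma pev_sum_monom:
  assumes "endo f" "x \<in> E" "finite I"
  shows "pev f (\<Sum>i\<in>I. monom (c i) i) x = (\<Sum>i\<in>I. scale (fps_const (c i)) ((f ^^ i) x))"
  using assms(3)
proof (induction I)
  case (insert i I)
  have "pev f (monom (c i) i) x = scale (fps_const (c i)) ((f ^^ i) x)"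
    by (simp add: monom_altdef pev_smult pev_var_power assms)
  with insert show ?case by (simp add: pev_add assms)
qed simp

text \<open>
  The reductions modulo b of the powers of f are matrices of complex numbers, hence they are
  linearly dependent.
\<close>

lemma pev_adic_1_exists:
  assumes f: "endo f"
  obtains P where "P \<noteq> 0" "\<And>x. x \<in> E \<Longrightarrow> pev f P x \<in> adic 1"
proof -
  obtain B where B: "finite B" "B \<subseteq> E" "independent B" "span B = E"
    and adic: "\<And>k x. x \<in> adic k \<longleftrightarrow> x \<in> E \<and> (\<forall>v\<in>B. \<forall>n<k. representation B x v $ n = 0)"
    by (rule basis_coordinates) blast
  \<comment> \<open>The matrix of the i-th power of f modulo b. It is extended by zero to all pairs,
    so that it lives in a plain function space but stays in the span of finitely many elementary
    matrices.\<close>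
  define W where "W i = (\<lambda>(u, v). if u \<in> B \<and> v \<in> B then representation B ((f ^^ i) u) v $ 0 else 0)" for i
  interpret V: vector_space "\<lambda>c (g :: 'e \<times> 'e \<Rightarrow> complex) p. c * g p"
    by standard (auto simp: fun_eq_iff algebra_simps)
  have rel: "pev f (\<Sum>i\<in>I. monom (c i) i) x \<in> adic 1"
    if I: "finite I" and c: "(\<Sum>i\<in>I. (\<lambda>p. c i * W i p)) = 0" and x: "x \<in> E" for I c x
  proof -
    have basis: "pev f (\<Sum>i\<in>I. monom (c i) i) u \<in> adic 1" if u: "u \<in> B" for u
      unfolding adic
    proof (intro conjI ballI allI impI)
      show "pev f (\<Sum>i\<in>I. monom (c i) i) u \<in> E"
        using B(2) u f pev_closed by blast
      fix v and n :: nat assume v: "v \<in> B" and "n < 1"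
      have "representation B (pev f (\<Sum>i\<in>I. monom (c i) i) u) v $ 0 = (\<Sum>i\<in>I. c i * W i (u, v))"
        using u v B by (subst pev_sum_monom)
          (simp_all add: f I subset_iff representation_sum representation_scale funpow_closed
            fps_sum_nth W_def)
      also have "\<dots> = 0"
        using fun_cong[OF c, of "(u, v)"] by (simp add: sum_fun_apply)
      finally show "representation B (pev f (\<Sum>i\<in>I. monom (c i) i) u) v $ n = 0"
        using \<open>n < 1\<close> by simp
    qed
    have "(\<Sum>v\<in>B. scale (representation B x v) v) = x"
      by (rule sum_representation_eq) (use B x in auto)
    then have "pev f (\<Sum>i\<in>I. monom (c i) i) x =
        (\<Sum>v\<in>B. scale (representation B x v) (pev f (\<Sum>i\<in>I. monom (c i) i) v))"
      using B(2) endo_sum_arg[OF pev_endo[OF f], of B "\<lambda>v. scale (representation B x v) v"]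
      by (simp add: endo_scale[OF pev_endo[OF f]] subset_iff)
    then show ?thesis using basis by (auto intro!: adic_sum adic_scale)
  qed
  define T where "T = (\<lambda>p q. if q = p then 1 else 0 :: complex) ` (B \<times> B)"
  have T: "finite T" using B(1) by (simp add: T_def)
  have span_T: "W i \<in> V.span T" for i
  proof -
    have "W i = (\<Sum>p\<in>B \<times> B. (\<lambda>q. W i p * (if q = p then 1 else 0)))"
    proof
      fix q
      have "(\<Sum>p\<in>B \<times> B. W i p * (if q = p then 1 else 0)) = (\<Sum>p\<in>B \<times> B. if q = p then W i q else 0)"
        by (rule sum.cong) auto
      also have "\<dots> = W i q"
        using B(1) by (auto simp: W_def split: prod.splits)
      finally show "W i q = (\<Sum>p\<in>B \<times> B. (\<lambda>q. W i p * (if q = p then 1 else 0))) q"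
        by (simp add: sum_fun_apply)
    qed
    also have "\<dots> \<in> V.span T"
      by (intro V.span_sum V.span_scale V.span_base) (auto simp: T_def)
    finally show ?thesis .
  qed
  show ?thesis
  \<comment> \<open>Dependence is a property of sets, so two powers with the same matrix are treated
    apart; their difference is then the wanted polynomial. Otherwise there are
    \<open>card T + 1\<close> distinct matrices in the span of \<open>card T\<close>
    elements.\<close>
  proof (cases "inj_on W {..card T}")
    case False
    then obtain i j where ij: "i \<noteq> j" "W i = W j" by (auto simp: inj_on_def)
    define c where "c k = (if k = i then 1 else -1 :: complex)" for k
    show ?thesis
    proof
      show "(\<Sum>k\<in>{i, j}. monom (c k) k) \<noteq> 0"
        using ij by (auto simp: poly_eq_iff c_def dest: spec[of _ i])
      show "pev f (\<Sum>k\<in>{i, j}. monom (c k) k) x \<in> adic 1" if "x \<in> E" for x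
        by (rule rel) (use ij that in \<open>auto simp: c_def fun_eq_iff\<close>)
    qed
  next
    case True
    have "V.dependent (W ` {..card T})"
    proof (rule ccontr)
      assume "\<not> ?thesis"
      from V.independent_span_bound[OF T this] span_T have "card (W ` {..card T}) \<le> card T" by auto
      with True show False by (simp add: card_image)
    qed
    then obtain u k where u: "(\<Sum>v\<in>W ` {..card T}. (\<lambda>p. u v * v p)) = 0" "u (W k) \<noteq> 0" "k \<le> card T"
      by (subst (asm) V.dependent_finite) auto
    show ?thesis
    proof
      have "coeff (\<Sum>i\<le>card T. monom (u (W i)) i) k = u (W k)"
        using u(3) by (simp add: coeff_sum)
      with u(2) show "(\<Sum>i\<le>card T. monom (u (W i)) i) \<noteq> 0" by force
      show "pev f (\<Sum>i\<le>card T. monom (u (W i)) i) x \<in> adic 1" if "x \<in> E" for x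
        by (rule rel) (use u(1) that in \<open>simp_all add: sum.reindex[OF True]\<close>)
    qed
  qed
qed

text \<open>The divisibility makes \<open>pev f (S k) x\<close> a b-adic Cauchy sequence. The last
  conclusion, that the limit commutes with whatever commutes with f, is what later relates it to the
  projection onto a summand.\<close>

lemma pev_limit:
  assumes f: "endo f" and P: "\<And>x. x \<in> E \<Longrightarrow> pev f P x \<in> adic 1"
    and S: "\<And>k. P ^ k dvd S (Suc k) - S k"
  obtains s where "endo s" "\<And>x k. x \<in> E \<Longrightarrow> s x - pev f (S k) x \<in> adic k"
    "\<And>g x. endo g \<Longrightarrow> (\<And>x. x \<in> E \<Longrightarrow> g (f x) = f (g x)) \<Longrightarrow> x \<in> E \<Longrightarrow> g (s x) = s (g x)"
proof -
  have "\<exists>y\<in>E. \<forall>k. y - pev f (S k) x \<in> adic k" if x: "x \<in> E" for x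
  proof -
    have "pev f (S (Suc k)) x - pev f (S k) x \<in> adic k" for k
      using pev_adic_dvd[OF f P x S] by (simp add: pev_diff f x)
    then show ?thesis
      using adic_complete[of "\<lambda>k. pev f (S k) x"] pev_closed[OF f x] by metis
  qed
  then obtain s where s: "\<And>x. x \<in> E \<Longrightarrow> s x \<in> E"
    "\<And>x k. x \<in> E \<Longrightarrow> s x - pev f (S k) x \<in> adic k" by metis
  \<comment> \<open>Limits are unique, so every algebraic property of \<open>s\<close> follows by
    showing that the other side of the equation is a limit of the same sequence.\<close>
  have uniq: "y = s x" if "x \<in> E" "\<And>k. y - pev f (S k) x \<in> adic k" for x y
  proof -
    have "y - s x \<in> adic k" for k
      using adic_diff[OF that(2)[of k] s(2)[OF that(1), of k]] by simp
    then show ?thesis using adic_separated by fastforce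
  qed
  note pe = pev_endo[OF f]
  show ?thesis
  proof (rule that)
    show "endo s"
    proof (rule endoI)
      show "s (x + y) = s x + s y" if "x \<in> E" "y \<in> E" for x y
        using adic_add[OF s(2)[OF that(1)] s(2)[OF that(2)]] that
        by (intro uniq[symmetric]) (simp_all add: endo_add[OF pe] algebra_simps)
      show "s (scale r x) = scale r (s x)" if "x \<in> E" for r x
        using adic_scale[OF s(2)[OF that]] that
        by (intro uniq[symmetric]) (simp_all add: endo_scale[OF pe] scale_right_diff_distrib)
      show "s (a x) = a (s x)" if "x \<in> E" for x
        using a_adic[OF s(2)[OF that]] that
        by (intro uniq[symmetric]) (simp_all add: endo_a[OF pe] a_diff s(1) pev_closed f)
    qed (rule s)
    show "g (s x) = s (g x)"
      if g: "endo g" "\<And>x. x \<in> E \<Longrightarrow> g (f x) = f (g x)" and x: "x \<in> E" for g x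
      using endo_adic[OF g(1) s(2)[OF x]] x
      by (intro uniq)
        (simp_all add: endo_closed[OF g(1)] endo_diff[OF g(1)] s(1) pev_closed f pev_commute[OF f g])
  qed (rule s)
qed

text \<open>
  The generalized Drazin inverse s of f: the idempotent f s splits E into a part on which f is
  invertible and a part on which f is nilpotent modulo b. It is the limit of the polynomials
  in f that give the Drazin inverses modulo the powers of b.
\<close>

lemma drazin_inverse:
  assumes f: "endo f"
  obtains s N where "endo s"
    "\<And>g x. endo g \<Longrightarrow> (\<And>x. x \<in> E \<Longrightarrow> g (f x) = f (g x)) \<Longrightarrow> x \<in> E \<Longrightarrow> g (s x) = s (g x)"
    "\<And>x. x \<in> E \<Longrightarrow> f (s (f (s x))) = f (s x)"
    "\<And>x. x \<in> E \<Longrightarrow> (f ^^ N) (x - f (s x)) \<in> adic 1"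
proof -
  obtain P where P: "P \<noteq> 0" "\<And>x. x \<in> E \<Longrightarrow> pev f P x \<in> adic 1"
    using pev_adic_1_exists[OF f] by blast
  define t where "t = [:0, 1 :: complex:]"
  define N where "N = order 0 P"
  obtain Q where PQ: "P = t ^ N * Q" and Q: "\<not> t dvd Q"
    using order_decomp[OF P(1), of 0] by (auto simp: t_def N_def)
  have "prime_elem t"
    unfolding t_def by (rule prime_elem_linear_field_poly) simp
  then have cop: "coprime t Q" using Q by (rule prime_elem_imp_coprime)
  \<comment> \<open>The exponent is N k + 1 so that one factor t can be split off:
    \<open>S k\<close> below is then still divisible by \<open>t ^ (N * k)\<close>, while
    \<open>t * S k\<close> is 1 modulo \<open>Q ^ k\<close>. Thus \<open>S k\<close> is the Drazin
    inverse of t modulo \<open>P ^ k\<close>.\<close>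
  have "\<exists>u v. u * t ^ (N * k + 1) + v * Q ^ k = 1" for k
    using cop bezout_coefficients_fst_snd[of "t ^ (N * k + 1)" "Q ^ k"]
    by (metis coprime_imp_gcd_eq_1 coprime_power_left_iff coprime_power_right_iff)
  then obtain u v where uv: "\<And>k. u k * t ^ (N * k + 1) + v k * Q ^ k = 1" by metis
  define S where "S k = u k * t ^ (N * k)" for k
  have tS: "t * S k = 1 - v k * Q ^ k" for k
    using uv[of k] by (simp add: S_def algebra_simps)
  \<comment> \<open>Successive choices agree modulo both coprime factors of \<open>P ^ k\<close>:
    modulo \<open>t ^ (N * k)\<close> both are 0, and modulo \<open>Q ^ k\<close> both invert
    t.\<close>
  have "P ^ k dvd S (Suc k) - S k" for k
  proof -
    have "t ^ (N * k) dvd t ^ (N * Suc k)" by (rule le_imp_power_dvd) simp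
    then have 1: "t ^ (N * k) dvd S (Suc k) - S k"
      by (auto simp: S_def intro!: dvd_diff dvd_mult)
    have "t * (S (Suc k) - S k) = Q ^ k * (v k - v (Suc k) * Q)"
      by (simp add: right_diff_distrib tS)
    then have "Q ^ k dvd t * (S (Suc k) - S k)" by simp
    then have "Q ^ k dvd S (Suc k) - S k"
      using cop by (metis coprime_commute coprime_dvd_mult_right_iff coprime_power_left_iff)
    with 1 have "t ^ (N * k) * Q ^ k dvd S (Suc k) - S k"
      using cop by (intro divides_mult) auto
    then show ?thesis by (simp add: PQ power_mult power_mult_distrib)
  qed
  then obtain s where s: "endo s" "\<And>x k. x \<in> E \<Longrightarrow> s x - pev f (S k) x \<in> adic k"
    "\<And>g x. endo g \<Longrightarrow> (\<And>x. x \<in> E \<Longrightarrow> g (f x) = f (g x)) \<Longrightarrow> x \<in> E \<Longrightarrow> g (s x) = s (g x)"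
    using pev_limit[OF f P(2)] by blast
  have e: "f (s x) - pev f (t * S k) x \<in> adic k" if "x \<in> E" for x k
    using endo_adic[OF f s(2)[OF that, of k]] that
    by (simp add: endo_diff f endo_closed[OF s(1)] pev_closed pev_mult pev_var t_def del: mult_pCons_left)
  have idem: "f (s (f (s x))) = f (s x)" if x: "x \<in> E" for x
  proof -
    note cl = x endo_closed[OF f] endo_closed[OF s(1)] pev_closed[OF f]
    have "f (s (f (s x))) - f (s x) \<in> adic k" for k
    proof -
      \<comment> \<open>\<open>t * S k\<close> is idempotent modulo \<open>P ^ k\<close>, since it
        is divisible by \<open>t ^ (N * k)\<close> and its complement \<open>v k * Q ^ k\<close> by
        \<open>Q ^ k\<close>.\<close>
      have "P ^ k dvd t * S k * (t * S k) - t * S k"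
      proof -
        have "t * S k * (t * S k) - t * S k = t * S k * (t * S k - 1)" by (simp add: algebra_simps)
        also have "\<dots> = (t ^ N * Q) ^ k * - (t * u k * v k)"
          by (subst (2) tS) (simp add: S_def power_mult power_mult_distrib)
        finally show ?thesis by (metis PQ dvd_triv_left)
      qed
      from pev_adic_dvd[OF f P(2) x this]
      have 1: "pev f (t * S k) (pev f (t * S k) x) - pev f (t * S k) x \<in> adic k"
        by (simp add: pev_diff pev_mult[OF f, of _ "t * S k"] f cl)
      have 2: "pev f (t * S k) (f (s x)) - pev f (t * S k) (pev f (t * S k) x) \<in> adic k"
        using endo_adic[OF pev_endo[OF f] e[OF x]] by (simp add: endo_diff[OF pev_endo[OF f]] cl)
      have 3: "f (s (f (s x))) - pev f (t * S k) (f (s x)) \<in> adic k"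
        using e cl by simp
      show ?thesis
        using adic_diff[OF adic_add[OF adic_add[OF 1 2] 3] e[OF x, of k]] by simp
    qed
    from adic_separated[OF this] show ?thesis by simp
  qed
  have nil: "(f ^^ N) (x - f (s x)) \<in> adic 1" if x: "x \<in> E" for x
  proof -
    \<comment> \<open>The approximation of index 1 suffices modulo b: \<open>1 - t * S 1\<close>
      equals \<open>v 1 * Q\<close>, and the factor \<open>t ^ N\<close> completes Q to P.\<close>
    have "P ^ 1 dvd t ^ N - t ^ N * (t * S 1)"
      by (auto simp: tS PQ algebra_simps)
    from pev_adic_dvd[OF f P(2) x this]
    have 1: "pev f (t ^ N) (x - pev f (t * S 1) x) \<in> adic 1"
      by (simp only: pev_diff[OF f x] pev_mult[OF f x, of "t ^ N" "t * S 1"]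
          endo_diff[OF pev_endo[OF f] x pev_closed[OF f x]])
    have 2: "pev f (t ^ N) (f (s x) - pev f (t * S 1) x) \<in> adic 1"
      by (rule endo_adic[OF pev_endo[OF f] e[OF x]])
    have "pev f (t ^ N) (x - f (s x)) \<in> adic 1"
      using adic_diff[OF 1 2] x
      by (simp add: endo_diff[OF pev_endo[OF f]] pev_closed f endo_closed[OF f] endo_closed[OF s(1)])
    then show ?thesis
      using x by (simp add: t_def pev_var_power f endo_closed[OF f] endo_closed[OF s(1)])
  qed
  show ?thesis by (rule that[OF s(1,3) idem nil])
qed

section \<open>Corners p End(E) p and their locality\<close>

lemma sub_ab_module_image:
  assumes f: "endo f" and sub: "f ` E \<subseteq> M"
  shows "sub_ab_module scale M a (f ` E)"
  unfolding sub_ab_module_def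
proof (intro conjI subspaceI sub)
  show "0 \<in> f ` E" using endo_0[OF f] by force
  show "x + y \<in> f ` E" if xy: "x \<in> f ` E" "y \<in> f ` E" for x y
  proof -
    obtain x' y' where "x' \<in> E" "y' \<in> E" "x = f x'" "y = f y'" using xy by blast
    then show ?thesis by (auto simp: endo_add[OF f] intro: image_eqI[of _ _ "x' + y'"])
  qed
  show "scale r x \<in> f ` E" if x: "x \<in> f ` E" for r x
  proof -
    obtain x' where "x' \<in> E" "x = f x'" using x by blast
    then show ?thesis by (auto simp: endo_scale[OF f] intro: image_eqI[of _ _ "scale r x'"])
  qed
  show "a ` f ` E \<subseteq> f ` E"
    by (auto simp flip: endo_a[OF f])
qed

text \<open>Membership in the ring p End(E) p, which is the endomorphism ring of p E when p is
  idempotent. In particular \<open>corner p p\<close> says that p is an idempotent endomorphism; p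
  is the identity of this ring.\<close>

definition corner :: "('e \<Rightarrow> 'e) \<Rightarrow> ('e \<Rightarrow> 'e) \<Rightarrow> bool" where
  "corner p f \<longleftrightarrow> endo f \<and> (\<forall>x\<in>E. p (f x) = f x \<and> f (p x) = f x)"

definition corner_unit :: "('e \<Rightarrow> 'e) \<Rightarrow> ('e \<Rightarrow> 'e) \<Rightarrow> bool" where
  "corner_unit p f \<longleftrightarrow> (\<exists>s. corner p s \<and> (\<forall>x\<in>E. f (s x) = p x \<and> s (f x) = p x))"

lemma corner_comp: "corner p f \<Longrightarrow> corner p g \<Longrightarrow> corner p (\<lambda>x. f (g x))"
  unfolding corner_def using endo_comp[of f g] endo_closed[of g] by simp

text \<open>An idempotent \<open>e\<close> of the corner splits p E into the images of e and p - e,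
  so one of the two must vanish.\<close>

lemma indecomposable_corner:
  assumes p: "corner p p" and ind: "indecomposable scale (p ` E) a"
    and e: "corner p e" and idem: "\<And>x. x \<in> E \<Longrightarrow> e (e x) = e x"
  shows "(\<forall>x\<in>E. e x = 0) \<or> (\<forall>x\<in>E. e x = p x)"
proof (rule ccontr)
  assume contra: "\<not> ?thesis"
  have endo: "endo p" "endo e" and rel: "\<And>x. x \<in> E \<Longrightarrow> p (p x) = p x"
    "\<And>x. x \<in> E \<Longrightarrow> p (e x) = e x" "\<And>x. x \<in> E \<Longrightarrow> e (p x) = e x"
    using p e by (auto simp: corner_def)
  note cl = endo_closed[OF endo(1)] endo_closed[OF endo(2)]
  define q where "q x = p x - e x" for x
  have q: "endo q" unfolding q_def using endo by (rule endo_minus)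
  have sub: "sub_ab_module scale (p ` E) a (e ` E)" "sub_ab_module scale (p ` E) a (q ` E)"
  proof (safe intro!: sub_ab_module_image endo q)
    fix x assume "x \<in> E"
    then show "e x \<in> p ` E" "q x \<in> p ` E"
      by (auto simp: q_def endo_diff[OF endo(1)] rel cl intro: image_eqI[of _ _ "e x"] image_eqI[of _ _ "p x - e x"])
  qed
  have eq: "e (e x + q y) = e x" if "x \<in> E" "y \<in> E" for x y
    using that by (simp add: q_def endo_add[OF endo(2)] endo_diff[OF endo(2)] cl rel idem)
  have "direct_sum2 (p ` E) (e ` E) (q ` E)"
    unfolding direct_sum2_def
  proof (rule bij_betw_imageI)
    show "inj_on (\<lambda>(x, y). x + y) (e ` E \<times> q ` E)"
    proof (rule inj_onI, clarify)
      fix x y x' y' assume "x \<in> E" "y \<in> E" "x' \<in> E" "y' \<in> E" and *: "e x + q y = e x' + q y'"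
      then have "e x = e x'" using eq by metis
      with * show "e x = e x' \<and> q y = q y'" by simp
    qed
    show "(\<lambda>(x, y). x + y) ` (e ` E \<times> q ` E) = p ` E"
    proof (intro equalityI subsetI)
      fix z assume "z \<in> (\<lambda>(x, y). x + y) ` (e ` E \<times> q ` E)"
      then obtain x y where "x \<in> E" "y \<in> E" "z = e x + q y" by auto
      then show "z \<in> p ` E"
        by (auto simp: q_def endo_diff[OF endo(1)] endo_add[OF endo(1)] rel cl
            intro!: image_eqI[of _ _ "e x + (p y - e y)"])
    next
      fix z assume "z \<in> p ` E"
      then obtain x where "x \<in> E" "z = p x" by blast
      then show "z \<in> (\<lambda>(x, y). x + y) ` (e ` E \<times> q ` E)"
        by (intro image_eqI[of _ _ "(e x, q x)"]) (auto simp: q_def)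
    qed
  qed
  moreover have "e ` E \<noteq> {0}"
    using contra by blast
  moreover have "q ` E \<noteq> {0}"
  proof -
    obtain x where "x \<in> E" "q x \<noteq> 0" using contra by (auto simp: q_def)
    then show ?thesis by blast
  qed
  ultimately show False using ind sub unfolding indecomposable_def by blast
qed

text \<open>The idempotent f s lies in the corner, hence is 0 or p. If it is 0, the Drazin property
  says that f is nilpotent modulo b; if it is p, then s inverts f on p E.\<close>

lemma corner_unit_or_nilpotent:
  assumes p: "corner p p" and ind: "indecomposable scale (p ` E) a" and f: "corner p f"
  shows "corner_unit p f \<or> (\<exists>N. \<forall>x\<in>E. (f ^^ N) x \<in> adic 1)"
proof -
  have endo: "endo p" "endo f" and rel: "\<And>x. x \<in> E \<Longrightarrow> p (p x) = p x"
    "\<And>x. x \<in> E \<Longrightarrow> p (f x) = f x" "\<And>x. x \<in> E \<Longrightarrow> f (p x) = f x"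
    using p f by (auto simp: corner_def)
  obtain s N where s: "endo s"
    and comm: "\<And>g x. endo g \<Longrightarrow> (\<And>x. x \<in> E \<Longrightarrow> g (f x) = f (g x)) \<Longrightarrow> x \<in> E \<Longrightarrow> g (s x) = s (g x)"
    and idem: "\<And>x. x \<in> E \<Longrightarrow> f (s (f (s x))) = f (s x)"
    and nil: "\<And>x. x \<in> E \<Longrightarrow> (f ^^ N) (x - f (s x)) \<in> adic 1"
    by (rule drazin_inverse[OF endo(2)]) blast
  note cl = endo_closed[OF endo(1)] endo_closed[OF endo(2)] endo_closed[OF s]
  \<comment> \<open>f absorbs p on both sides, so p commutes with f and therefore with its Drazin
    inverse.\<close>
  have sp: "p (s x) = s (p x)" if "x \<in> E" for x
    by (rule comm[OF endo(1) _ that]) (simp add: rel)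
  have sf: "f (s x) = s (f x)" if "x \<in> E" for x
    by (rule comm[OF endo(2) _ that]) simp
  have "corner p (\<lambda>x. f (s x))"
    unfolding corner_def using endo_comp[OF endo(2) s] by (auto simp: rel cl simp flip: sp)
  then consider "\<forall>x\<in>E. f (s x) = 0" | "\<forall>x\<in>E. f (s x) = p x"
    using indecomposable_corner[OF p ind _ idem] by blast
  then show ?thesis
  proof cases
    case 1
    then show ?thesis using nil by force
  next
    case 2
    have "corner p (\<lambda>x. s (p x))"
      unfolding corner_def using endo_comp[OF s endo(1)] by (auto simp: rel cl sp)
    with 2 have "corner_unit p f"
      unfolding corner_unit_def
      by (intro exI[of _ "\<lambda>x. s (p x)"]) (auto simp: rel cl simp flip: sf)
    then show ?thesis ..
  qed
qed

lemma not_nilpotent_complement: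
  assumes p: "corner p p" and "x0 \<in> E" "p x0 \<noteq> 0"
    and f: "corner p f" and g: "corner p g" and sum: "\<And>x. x \<in> E \<Longrightarrow> f x + g x = p x"
    and fN: "\<And>x. x \<in> E \<Longrightarrow> (f ^^ N) x \<in> adic 1" and gN: "\<And>x. x \<in> E \<Longrightarrow> (g ^^ N') x \<in> adic 1"
  shows False
proof -
  have endo: "endo p" "endo f" "endo g" and rel: "\<And>x. x \<in> E \<Longrightarrow> p (p x) = p x"
    "\<And>x. x \<in> E \<Longrightarrow> p (f x) = f x" "\<And>x. x \<in> E \<Longrightarrow> f (p x) = f x"
    "\<And>x. x \<in> E \<Longrightarrow> p (g x) = g x" "\<And>x. x \<in> E \<Longrightarrow> g (p x) = g x"
    using p f g by (auto simp: corner_def)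
  note cl = endo_closed[OF endo(1)] endo_closed[OF endo(2)] endo_closed[OF endo(3)]
  \<comment> \<open>On p E the sum condition reads g = 1 - f, so powers of g are values at f of
    powers of the polynomial 1 - t.\<close>
  have pow: "pev f ([:1, -1:] ^ n) x = (g ^^ n) x \<and> p ((g ^^ n) x) = (g ^^ n) x"
    if "x \<in> E" "p x = x" for n x
  proof (induction n)
    case 0
    then show ?case by (simp add: pev_1 endo that)
  next
    case (Suc n)
    define y where "y = (g ^^ n) x"
    have y: "y \<in> E" "p y = y" using Suc that funpow_closed[OF endo(3)] by (auto simp: y_def)
    have "g y = y - f y" using sum[OF y(1)] y(2) by (simp add: algebra_simps)
    also have "\<dots> = pev f [:1, -1:] y"
      using y(1) by (simp add: pev_pCons endo endo_0 endo_neg[OF endo(2)] flip: fps_const_neg)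
    finally show ?case
      using y Suc that rel(4)[OF y(1)]
      by (simp add: pev_mult endo flip: y_def del: mult_pCons_left)
  qed
  have "coprime ([:0, 1:] ^ N) ([:1, -1 :: complex:] ^ N')"
  proof -
    have "coprime [:0, 1:] [:1, -1 :: complex:]"
    proof (rule coprimeI)
      fix d :: "complex poly" assume "d dvd [:0, 1:]" "d dvd [:1, -1:]"
      then have "d dvd [:0, 1:] + [:1, -1:]" by (rule dvd_add)
      then show "is_unit d" by (simp add: one_pCons)
    qed
    then show ?thesis by simp
  qed
  then obtain u v where uv: "u * [:0, 1:] ^ N + v * [:1, -1 :: complex:] ^ N' = 1"
    by (metis bezout_coefficients_fst_snd coprime_imp_gcd_eq_1)
  have 1: "x \<in> adic 1" if x: "x \<in> E" "p x = x" for x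
  proof -
    have "x = pev f (u * [:0, 1:] ^ N + v * [:1, -1:] ^ N') x" by (simp only: uv pev_1 endo)
    also have "\<dots> = pev f u ((f ^^ N) x) + pev f v ((g ^^ N') x)"
      by (simp only: pev_add[OF endo(2) x(1)] pev_mult[OF endo(2) x(1)]
          pev_var_power[OF endo(2) x(1)] conjunct1[OF pow[OF x]])
    also have "\<dots> \<in> adic 1" 
      by (intro adic_add endo_adic[OF pev_endo[OF endo(2)]] fN gN x)
    finally show ?thesis .
  qed
  \<comment> \<open>Nakayama's argument by hand: writing x = b y gives x = p x = b (p y), so p E is
    contained in b (p E), and iteration puts it into every \<open>adic k\<close>.\<close>
  have "x \<in> adic k" if "x \<in> E" "p x = x" for x k
    using that
  proof (induction k arbitrary: x)
    case 0
    then show ?case by (simp add: adic_0)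
  next
    case (Suc k)
    obtain y where y: "y \<in> E" "x = scale fps_X y"
      using adicE[OF 1[OF Suc.prems]] by auto
    have "p y \<in> adic k" by (rule Suc.IH) (use y cl rel in auto)
    moreover have "x = scale fps_X (p y)"
      using Suc.prems(2) y by (simp add: endo_scale[OF endo(1)])
    ultimately show ?case by (simp add: adic_scale_X)
  qed
  then have "p x0 = 0" by (intro adic_separated) (use assms(2) cl rel in auto)
  with assms(3) show False by simp
qed

text \<open>Multiplying by the inverse s of f + g turns the sum into p, so f s and g s cannot both
  be nilpotent modulo b and one of them is a unit.\<close>

lemma corner_unit_add:
  assumes p: "corner p p" and ind: "indecomposable scale (p ` E) a" and x0: "x0 \<in> E" "p x0 \<noteq> 0"
    and f: "corner p f" and g: "corner p g" and unit: "corner_unit p (\<lambda>x. f x + g x)"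
  shows "corner_unit p f \<or> corner_unit p g"
proof -
  obtain s where s: "corner p s" "\<And>x. x \<in> E \<Longrightarrow> f (s x) + g (s x) = p x"
    "\<And>x. x \<in> E \<Longrightarrow> s (f x + g x) = p x"
    using unit by (auto simp: corner_unit_def)
  have endo: "endo p" "endo s" "endo f" "endo g" and rel: "\<And>x. x \<in> E \<Longrightarrow> p (p x) = p x"
    "\<And>x. x \<in> E \<Longrightarrow> p (s x) = s x" "\<And>x. x \<in> E \<Longrightarrow> s (p x) = s x"
    "\<And>x. x \<in> E \<Longrightarrow> p (f x) = f x" "\<And>x. x \<in> E \<Longrightarrow> f (p x) = f x"
    "\<And>x. x \<in> E \<Longrightarrow> p (g x) = g x" "\<And>x. x \<in> E \<Longrightarrow> g (p x) = g x"
    using p f g s(1) by (auto simp: corner_def)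
  note cl = endo_closed[OF endo(1)] endo_closed[OF endo(2)] endo_closed[OF endo(3)] endo_closed[OF endo(4)]
  have cor: "corner p (\<lambda>x. h (s x))" if "corner p h" for h
    using that s(1) by (rule corner_comp)
  have lift: "corner_unit p h" if h: "corner p h" and u: "corner_unit p (\<lambda>x. h (s x))" for h
  proof -
    obtain t where t: "corner p t" "\<And>x. x \<in> E \<Longrightarrow> h (s (t x)) = p x" "\<And>x. x \<in> E \<Longrightarrow> t (h (s x)) = p x"
      using u by (auto simp: corner_unit_def)
    have endo': "endo t" "endo h" and rel': "\<And>x. x \<in> E \<Longrightarrow> p (t x) = t x" "\<And>x. x \<in> E \<Longrightarrow> t (p x) = t x"
      "\<And>x. x \<in> E \<Longrightarrow> p (h x) = h x" "\<And>x. x \<in> E \<Longrightarrow> h (p x) = h x"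
      using t(1) h by (auto simp: corner_def)
    note cl' = cl endo_closed[OF endo'(1)] endo_closed[OF endo'(2)]
    have "s (t (h x)) = p x" if x: "x \<in> E" for x
    proof -
      \<comment> \<open>That \<open>s t\<close> is a right inverse of \<open>h\<close> is immediate.
        For the left inverse, \<open>k\<close> is the inverse of s: inserting s k = p into t h s = p
        yields t h = p k, and applying s gives s t h = p.\<close>
      define k where "k y = f y + g y" for y
      have k: "k y \<in> E" "s (k y) = p y" if "y \<in> E" for y
        using that s(3) cl by (auto simp: k_def)
      have "p (k x) = t (h (s (k x)))" using t(3) k(1)[OF x] by simp
      also have "\<dots> = t (h x)" using x k(2) rel' by simp
      finally have "s (t (h x)) = s (k x)" using rel(3) k(1) x by metis
      then show ?thesis using k x by simp
    qed
    moreover have "corner p (\<lambda>x. s (t x))"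
      using s(1) t(1) by (rule corner_comp)
    ultimately show ?thesis using t(2) unfolding corner_unit_def by blast
  qed
  show ?thesis
    using corner_unit_or_nilpotent[OF p ind cor[OF f]] corner_unit_or_nilpotent[OF p ind cor[OF g]]
      lift[OF f] lift[OF g] not_nilpotent_complement[OF p x0 cor[OF f] cor[OF g] s(2)]
    by blast
qed

lemma corner_sum:
  assumes p: "corner p p" and f: "\<And>j. j \<in> J \<Longrightarrow> corner p (f j)"
  shows "corner p (\<lambda>x. \<Sum>j\<in>J. f j x)"
proof -
  have "endo p" "\<And>j. j \<in> J \<Longrightarrow> endo (f j)" using p f by (auto simp: corner_def)
  then show ?thesis
    using p f by (auto simp: corner_def endo_sum endo_sum_arg endo_closed intro!: sum.cong)
qed

lemma corner_unit_sum:
  assumes p: "corner p p" and ind: "indecomposable scale (p ` E) a" and x0: "x0 \<in> E" "p x0 \<noteq> 0"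
    and "finite J" and "\<And>j. j \<in> J \<Longrightarrow> corner p (f j)"
    and "corner_unit p (\<lambda>x. \<Sum>j\<in>J. f j x)"
  shows "\<exists>j\<in>J. corner_unit p (f j)"
  using assms(5-)
proof (induction J)
  case empty
  then show ?case
    using x0 endo_0 unfolding corner_unit_def corner_def by force
next
  case (insert j J)
  have "corner_unit p (\<lambda>x. f j x + (\<Sum>j\<in>J. f j x))"
    using insert.prems(2) insert.hyps by simp
  from corner_unit_add[OF p ind x0 insert.prems(1) corner_sum[OF p] this] insert
  show ?case by blast
qed

section \<open>Decompositions as systems of projections, and the exchange of summands\<close>

definition projections :: "'i set \<Rightarrow> ('i \<Rightarrow> 'e set) \<Rightarrow> ('i \<Rightarrow> 'e \<Rightarrow> 'e) \<Rightarrow> bool" where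
  "projections I G \<pi> \<longleftrightarrow> finite I \<and>
     (\<forall>i\<in>I. endo (\<pi> i) \<and> G i \<subseteq> E \<and> (\<forall>x\<in>E. \<pi> i x \<in> G i) \<and>
        (\<forall>x\<in>G i. \<pi> i x = x) \<and> (\<forall>j\<in>I. i \<noteq> j \<longrightarrow> (\<forall>x\<in>G j. \<pi> i x = 0))) \<and>
     (\<forall>x\<in>E. (\<Sum>i\<in>I. \<pi> i x) = x)"

lemma
  assumes "projections I G \<pi>"
  shows projections_finite: "finite I"
    and projections_endo: "i \<in> I \<Longrightarrow> endo (\<pi> i)"
    and projections_subset: "i \<in> I \<Longrightarrow> x \<in> G i \<Longrightarrow> x \<in> E"
    and projections_mem: "i \<in> I \<Longrightarrow> x \<in> E \<Longrightarrow> \<pi> i x \<in> G i"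
    and projections_same: "i \<in> I \<Longrightarrow> x \<in> G i \<Longrightarrow> \<pi> i x = x"
    and projections_other: "i \<in> I \<Longrightarrow> j \<in> I \<Longrightarrow> i \<noteq> j \<Longrightarrow> x \<in> G j \<Longrightarrow> \<pi> i x = 0"
    and projections_sum: "x \<in> E \<Longrightarrow> (\<Sum>i\<in>I. \<pi> i x) = x"
  using assms unfolding projections_def by blast+

lemma projectionsI:
  assumes "finite I" "\<And>i. i \<in> I \<Longrightarrow> endo (\<pi> i)" "\<And>i x. i \<in> I \<Longrightarrow> x \<in> G i \<Longrightarrow> x \<in> E"
    and "\<And>i x. i \<in> I \<Longrightarrow> x \<in> E \<Longrightarrow> \<pi> i x \<in> G i"
    and "\<And>i j x. i \<in> I \<Longrightarrow> j \<in> I \<Longrightarrow> x \<in> G j \<Longrightarrow> \<pi> i x = (if i = j then x else 0)"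
    and "\<And>x. x \<in> E \<Longrightarrow> (\<Sum>i\<in>I. \<pi> i x) = x"
  shows "projections I G \<pi>"
proof -
  have "\<pi> i x = x" if "i \<in> I" "x \<in> G i" for i x
    using assms(5)[OF that(1,1,2)] by simp
  moreover have "\<pi> i x = 0" if "i \<in> I" "j \<in> I" "i \<noteq> j" "x \<in> G j" for i j x
    using assms(5)[OF that(1,2,4)] that(3) by simp
  ultimately show ?thesis
    unfolding projections_def using assms(1-4,6) by blast
qed

lemma projections_image:
  assumes "projections I G \<pi>" "i \<in> I"
  shows "\<pi> i ` E = G i"
proof (intro equalityI subsetI)
  fix x assume x: "x \<in> G i"
  show "x \<in> \<pi> i ` E"
    using projections_same[OF assms x] projections_subset[OF assms x] by (metis imageI)
qed (use projections_mem[OF assms] in blast)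

lemma projections_corner: "projections I G \<pi> \<Longrightarrow> i \<in> I \<Longrightarrow> corner (\<pi> i) (\<pi> i)"
  unfolding corner_def using projections_endo projections_mem projections_same by metis

text \<open>Components are read off from the inverse of the summation bijection. Each
  \<open>G i\<close> is stable under the module operations and a, so applying an operation to the
  components decomposes its result, and uniqueness of components makes each projection a
  morphism.\<close>

lemma direct_sum_projections:
  assumes I: "finite I" and G: "\<And>i. i \<in> I \<Longrightarrow> sub_ab_module scale E a (G i)"
    and sum: "direct_sum E I G"
  obtains \<pi> where "projections I G \<pi>"
proof -
  define \<pi> where "\<pi> i x = inv_into (Pi\<^sub>E I G) (\<lambda>f. \<Sum>i\<in>I. f i) x i" for i x
  have G: "i \<in> I \<Longrightarrow> subspace (G i)" "i \<in> I \<Longrightarrow> x \<in> G i \<Longrightarrow> x \<in> E"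
    "i \<in> I \<Longrightarrow> x \<in> G i \<Longrightarrow> a x \<in> G i" for i x
    using G by (auto simp: sub_ab_module_def)
  have bij: "bij_betw (\<lambda>f. \<Sum>i\<in>I. f i) (Pi\<^sub>E I G) E"
    using sum by (simp add: direct_sum_def)
  have mem: "\<pi> i x \<in> G i" if "x \<in> E" "i \<in> I" for i x
    using inv_into_into[of x "\<lambda>f. \<Sum>i\<in>I. f i" "Pi\<^sub>E I G"] bij that
    by (auto simp: \<pi>_def bij_betw_def PiE_iff)
  have sum: "(\<Sum>i\<in>I. \<pi> i x) = x" if "x \<in> E" for x
    using bij_betw_inv_into_right[OF bij that] by (simp add: \<pi>_def)
  have uniq: "\<pi> i x = f i" if "\<And>i. i \<in> I \<Longrightarrow> f i \<in> G i" "(\<Sum>i\<in>I. f i) = x" "i \<in> I" for f x i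
  proof -
    have "(\<Sum>i\<in>I. restrict f I i) = x" using that(2) by simp
    then have "inv_into (Pi\<^sub>E I G) (\<lambda>f. \<Sum>i\<in>I. f i) x = restrict f I"
      using that(1) by (intro inv_into_f_eq[OF bij_betw_imp_inj_on[OF bij]]) auto
    then show ?thesis using that(3) by (simp add: \<pi>_def)
  qed
  have a_sum: "a (\<Sum>i\<in>J. g i) = (\<Sum>i\<in>J. a (g i))" if "\<And>i. i \<in> J \<Longrightarrow> g i \<in> E" for J :: "'i set" and g
    using that by (induction J rule: infinite_finite_induct) (auto simp: a_zero a_add E_sum)
  have "endo (\<pi> i)" if i: "i \<in> I" for i
  proof (rule endoI)
    show "\<pi> i x \<in> E" if "x \<in> E" for x
      using mem[OF that i] G(2) i by blast
    show "\<pi> i (x + y) = \<pi> i x + \<pi> i y" if "x \<in> E" "y \<in> E" for x y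
      by (rule uniq) (use that i in \<open>auto simp: sum.distrib sum mem intro: subspace_add G\<close>)
    show "\<pi> i (scale r x) = scale r (\<pi> i x)" if "x \<in> E" for r x
      by (rule uniq) (use that i in \<open>auto simp: sum mem simp flip: scale_sum_right intro: subspace_scale G\<close>)
    show "\<pi> i (a x) = a (\<pi> i x)" if x: "x \<in> E" for x
    proof (rule uniq)
      show "(\<Sum>i\<in>I. a (\<pi> i x)) = a x"
        using a_sum[of I "\<lambda>i. \<pi> i x"] sum[OF x] mem[OF x] G(2) by simp
    qed (use x i mem G in auto)
  qed
  moreover have "\<pi> i x = (if i = j then x else 0)" if "i \<in> I" "j \<in> I" "x \<in> G j" for i j x
    by (rule uniq) (use that I in \<open>auto intro: subspace_0 G\<close>)
  ultimately have "projections I G \<pi>"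
    using I G(2) mem sum by (intro projectionsI)
  then show ?thesis by (rule that)
qed

text \<open>The identity p of the corner is the sum of the elements p (\<open>\<rho> j\<close>) p,
  so by locality one of them is a unit, and its \<open>F j\<close> can replace \<open>G i\<close>.
  The other summands of G may themselves stem from earlier exchanges; the clause that
  \<open>\<pi> i\<close> does not vanish on \<open>F j\<close> excludes that \<open>F j\<close> is
  already among them.\<close>

lemma exchange:
  assumes \<pi>: "projections I G \<pi>" and \<rho>: "projections J F \<rho>" and i: "i \<in> I"
    and Gi: "G i \<noteq> {0}" "indecomposable scale (G i) a"
    and F: "\<And>j. j \<in> J \<Longrightarrow> indecomposable scale (F j) a"
  obtains j \<pi>' where "j \<in> J" "\<exists>x\<in>F j. \<pi> i x \<noteq> 0"
    "ab_isomorphic scale (G i) a scale (F j) a" "projections I (G(i := F j)) \<pi>'"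
proof -
  define p where "p = \<pi> i"
  have p: "corner p p" using projections_corner[OF \<pi> i] by (simp add: p_def)
  have pE: "p ` E = G i" using projections_image[OF \<pi> i] by (simp add: p_def)
  have pp: "endo p" "\<And>x. x \<in> E \<Longrightarrow> p (p x) = p x" using p by (auto simp: corner_def)
  have "0 \<in> G i" using imageI[OF E_zero, of p] endo_0[OF pp(1)] pE by simp
  with Gi(1) have "\<exists>y\<in>G i. y \<noteq> 0" by blast
  then obtain x0 where x0: "x0 \<in> E" "p x0 \<noteq> 0" unfolding pE[symmetric] by blast
  note \<rho>E = projections_endo[OF \<rho>]
  have cor: "corner p (\<lambda>x. p (\<rho> j (p x)))" if "j \<in> J" for j
    using endo_comp[OF pp(1) endo_comp[OF \<rho>E[OF that] pp(1)]] pp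
    by (simp add: corner_def endo_closed[OF pp(1)] endo_closed[OF \<rho>E[OF that]])
  have sum: "(\<Sum>j\<in>J. p (\<rho> j (p x))) = p x" if "x \<in> E" for x
    using endo_sum_arg[OF pp(1), of J "\<lambda>j. \<rho> j (p x)"] projections_sum[OF \<rho>, of "p x"] that pp
    by (simp add: endo_closed[OF pp(1)] endo_closed[OF \<rho>E])
  have "corner_unit p (\<lambda>x. \<Sum>j\<in>J. p (\<rho> j (p x)))"
    unfolding corner_unit_def using p pp sum by (intro exI[of _ p]) (simp add: endo_closed[OF pp(1)])
  with corner_unit_sum[OF p, of x0 J "\<lambda>j x. p (\<rho> j (p x))"] obtain j where j: "j \<in> J"
    and unit: "corner_unit p (\<lambda>x. p (\<rho> j (p x)))"
    using x0 cor Gi(2) projections_finite[OF \<rho>] unfolding pE by blast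
  define q where "q = \<rho> j"
  have q: "corner q q" "q ` E = F j"
    using projections_corner[OF \<rho> j] projections_image[OF \<rho> j] by (auto simp: q_def)
  obtain s where s: "corner p s" "\<And>x. x \<in> E \<Longrightarrow> p (q (p (s x))) = p x"
    "\<And>x. x \<in> E \<Longrightarrow> s (p (q (p x))) = p x"
    using unit by (auto simp: corner_unit_def q_def)
  have endo: "endo p" "endo q" "endo s" and rel: "\<And>x. x \<in> E \<Longrightarrow> q (q x) = q x"
    "\<And>x. x \<in> E \<Longrightarrow> p (s x) = s x" "\<And>x. x \<in> E \<Longrightarrow> s (p x) = s x"
    using p q s by (auto simp: corner_def)
  note cl = endo_closed[OF endo(1)] endo_closed[OF endo(2)] endo_closed[OF endo(3)]
  have psq: "p (q (s x)) = p x" and sqp: "s (q (p x)) = p x" if "x \<in> E" for x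
    using s(2,3)[OF that] rel that cl by auto
  \<comment> \<open>The projection onto \<open>F j\<close> along the kernel of p: the relations p r
    = p and r p = r say that r and p have the same kernel, which is why the other summands can
    stay.\<close>
  define r where "r x = q (s x)" for x
  have r: "endo r" unfolding r_def using endo(2,3) by (rule endo_comp)
  have rr: "r (r x) = r x" and qr: "q (r x) = r x" and pr: "p (r x) = p x" and rp: "r (p x) = r x"
    if "x \<in> E" for x
  proof -
    have "s (q (s x)) = s (q (p (s x)))" using that rel by simp
    also have "\<dots> = s x" using sqp[OF cl(3)[OF that]] rel that by simp
    finally show "r (r x) = r x" by (simp add: r_def)
  qed (use that rel cl psq in \<open>auto simp: r_def\<close>)
  note rcl = endo_closed[OF r]
  \<comment> \<open>So far the image of r is only known to lie in \<open>F j\<close>. As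
    \<open>F j\<close> is indecomposable, the nonzero idempotent r q equals q, and r fixes
    \<open>F j\<close> pointwise.\<close>
  have "corner q (\<lambda>x. r (q x))"
    unfolding corner_def using endo_comp[OF r endo(2)] by (simp add: qr rel cl)
  moreover have "indecomposable scale (q ` E) a" using F[OF j] q(2) by simp
  ultimately have "(\<forall>x\<in>E. r (q x) = 0) \<or> (\<forall>x\<in>E. r (q x) = q x)"
    using q(1) by (intro indecomposable_corner) (auto simp: qr rr cl)
  moreover have "\<not> (\<forall>x\<in>E. r (q x) = 0)"
  proof
    assume "\<forall>x\<in>E. r (q x) = 0"
    then have "r (q (r x0)) = 0" using x0(1) rcl by blast
    then have "r x0 = 0" using x0(1) by (simp add: qr rr)
    then show False using pr[OF x0(1)] x0(2) endo_0[OF endo(1)] by simp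
  qed
  ultimately have "\<forall>x\<in>E. r (q x) = q x" by blast
  then have rF: "r y = y" if "y \<in> F j" for y
    using that unfolding q(2)[symmetric] by (elim imageE) simp
  note FE = projections_subset[OF \<rho> j] and GE = projections_subset[OF \<pi> i]
    and pG = projections_same[OF \<pi> i, folded p_def] and qF = projections_mem[OF \<rho> j, folded q_def]
  have sG: "s x \<in> G i" if "x \<in> E" for x
    using projections_mem[OF \<pi> i cl(3)[OF that]] rel(2)[OF that] by (simp add: p_def)
  have "ab_isomorphic scale (G i) a scale (F j) a"
    unfolding ab_isomorphic_def
  proof (intro exI conjI)
    show "ab_morphism scale (G i) a scale (F j) a q"
      unfolding ab_morphism_def using GE qF
      by (auto simp: endo_add[OF endo(2)] endo_scale[OF endo(2)] endo_a[OF endo(2)])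
    show "bij_betw q (G i) (F j)"
    proof (rule bij_betwI[where g = s])
      show "s (q x) = x" if "x \<in> G i" for x
        using sqp[of x] that GE pG by auto
      show "q (s x) = x" if "x \<in> F j" for x
        using rF[OF that] by (simp add: r_def)
    qed (use qF sG GE FE in auto)
  qed
  moreover have "\<exists>x\<in>F j. \<pi> i x \<noteq> 0"
    using x0 pr[OF x0(1)] qF[OF cl(3)[OF x0(1)]] by (auto simp: r_def p_def intro!: bexI[of _ "q (s x0)"])
  \<comment> \<open>The component in \<open>F j\<close> is removed before the old projections are
    applied. Because p r = p, the remainder x - r x has no component in \<open>G i\<close>, and the
    other components recover it completely.\<close>
  moreover have "projections I (G(i := F j)) (\<lambda>l. if l = i then r else (\<lambda>x. \<pi> l (x - r x)))"
  proof (rule projectionsI)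
    show "finite I" by (rule projections_finite[OF \<pi>])
  next
    fix x assume x: "x \<in> E"
    have "(\<Sum>l\<in>I. \<pi> l (x - r x)) = x - r x"
      by (rule projections_sum[OF \<pi>]) (simp add: x rcl)
    moreover have "\<pi> i (x - r x) = 0"
      using x by (simp flip: p_def add: endo_diff[OF endo(1)] rcl pr)
    ultimately have "(\<Sum>l\<in>I - {i}. \<pi> l (x - r x)) = x - r x"
      using i projections_finite[OF \<pi>] by (simp add: sum.remove)
    then show "(\<Sum>l\<in>I. (if l = i then r else (\<lambda>x. \<pi> l (x - r x))) x) = x"
      using i projections_finite[OF \<pi>] by (simp add: sum.remove[of _ i])
  next
    fix l assume l: "l \<in> I"
    note \<pi>l = projections_endo[OF \<pi> l]
    show "endo (if l = i then r else (\<lambda>x. \<pi> l (x - r x)))"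
      using r endo_comp[OF \<pi>l endo_minus[OF endo_id r]] by simp
    show "x \<in> E" if "x \<in> (G(i := F j)) l" for x
      using that FE projections_subset[OF \<pi> l] by (auto split: if_splits)
    show "(if l = i then r else (\<lambda>x. \<pi> l (x - r x))) x \<in> (G(i := F j)) l" if "x \<in> E" for x
      using that projections_mem[OF \<pi> l, of "x - r x"] qF[OF cl(3)] rcl by (auto simp: r_def)
    fix k x assume k: "k \<in> I" and x: "x \<in> (G(i := F j)) k"
    have "x \<in> E" using x FE projections_subset[OF \<pi> k] by (auto split: if_splits)
    have "r x = 0" if "k \<noteq> i"
    proof -
      have "p x = 0" using projections_other[OF \<pi> i k] x that by (auto simp: p_def)
      then show ?thesis using rp[OF \<open>x \<in> E\<close>] endo_0[OF r] by simp
    qed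
    moreover have "\<pi> l x = (if l = k then x else 0)" if "k \<noteq> i"
      using that x projections_same[OF \<pi> l] projections_other[OF \<pi> l k] by auto
    ultimately show "(if l = i then r else (\<lambda>x. \<pi> l (x - r x))) x = (if l = k then x else 0)"
      using x rF endo_0[OF \<pi>l] by (auto split: if_splits)
  qed
  ultimately show ?thesis using j that by blast
qed

lemma krull_schmidt:
  assumes \<pi>: "projections I G \<pi>" and \<rho>: "projections J F \<rho>"
    and G: "\<And>i. i \<in> I \<Longrightarrow> G i \<noteq> {0} \<and> indecomposable scale (G i) a"
    and F: "\<And>j. j \<in> J \<Longrightarrow> F j \<noteq> {0} \<and> indecomposable scale (F j) a"
  obtains \<sigma> where "bij_betw \<sigma> I J" "\<And>i. i \<in> I \<Longrightarrow> ab_isomorphic scale (G i) a scale (F (\<sigma> i)) a"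
proof -
  \<comment> \<open>S is the set of indices already exchanged. The induction carries a full mixed
    decomposition, since each exchange must start from the result of the previous one.\<close>
  have "\<exists>\<sigma> \<tau>. inj_on \<sigma> S \<and> \<sigma> ` S \<subseteq> J \<and>
      (\<forall>i\<in>S. ab_isomorphic scale (G i) a scale (F (\<sigma> i)) a) \<and>
      projections I (\<lambda>i. if i \<in> S then F (\<sigma> i) else G i) \<tau>"
    if "finite S" "S \<subseteq> I" for S
    using that
  proof (induction S)
    case empty
    then show ?case using \<pi> by auto
  next
    case (insert i S)
    then obtain \<sigma> \<tau> where \<sigma>: "inj_on \<sigma> S" "\<sigma> ` S \<subseteq> J"
      "\<And>i. i \<in> S \<Longrightarrow> ab_isomorphic scale (G i) a scale (F (\<sigma> i)) a"
      and \<tau>: "projections I (\<lambda>i. if i \<in> S then F (\<sigma> i) else G i) \<tau>" (is "projections I ?H \<tau>")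
      by auto
    have i: "i \<in> I" using insert by simp
    have Hi: "?H i = G i" using insert.hyps by simp
    obtain j \<tau>' where j: "j \<in> J" "\<exists>x\<in>F j. \<tau> i x \<noteq> 0"
      "ab_isomorphic scale (G i) a scale (F j) a" "projections I (?H(i := F j)) \<tau>'"
      using exchange[OF \<tau> \<rho> i] G[OF i] F unfolding Hi by blast
    have "j \<notin> \<sigma> ` S"
    proof
      assume "j \<in> \<sigma> ` S"
      then obtain k where "k \<in> S" "j = \<sigma> k" by blast
      then have "\<tau> i x = 0" if "x \<in> F j" for x
        using that insert.prems insert.hyps by (intro projections_other[OF \<tau> i, of k]) auto
      with j(2) show False by blast
    qed
    moreover have "?H(i := F j) = (\<lambda>k. if k \<in> insert i S then F ((\<sigma>(i := j)) k) else G k)"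
      using insert.hyps by (auto simp: fun_eq_iff)
    ultimately show ?case
      using \<sigma> j insert.hyps
      by (intro exI[of _ "\<sigma>(i := j)"] exI[of _ \<tau>']) (auto simp: inj_on_def)
  qed
  from this[OF projections_finite[OF \<pi>] order_refl] obtain \<sigma> \<tau> where
    \<sigma>: "inj_on \<sigma> I" "\<sigma> ` I \<subseteq> J"
      "\<And>i. i \<in> I \<Longrightarrow> ab_isomorphic scale (G i) a scale (F (\<sigma> i)) a"
      and \<tau>: "projections I (\<lambda>i. if i \<in> I then F (\<sigma> i) else G i) \<tau>"
    by blast
  \<comment> \<open>Once every index is exchanged, the modules \<open>F (\<sigma> i)\<close> alone
    span E. For j outside the image of \<open>\<sigma>\<close>, the projection
    \<open>\<rho> j\<close> kills all of them, which would force \<open>F j\<close> to be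
    zero.\<close>
  have "J \<subseteq> \<sigma> ` I"
  proof
    fix j assume j: "j \<in> J"
    show "j \<in> \<sigma> ` I"
    proof (rule ccontr)
      assume notin: "j \<notin> \<sigma> ` I"
      have "x = 0" if x: "x \<in> F j" for x
      proof -
        have xE: "x \<in> E" using projections_subset[OF \<rho> j x] .
        have *: "\<tau> i x \<in> F (\<sigma> i)" if "i \<in> I" for i
          using projections_mem[OF \<tau> that xE] that by simp
        have "x = \<rho> j (\<Sum>i\<in>I. \<tau> i x)"
          using projections_sum[OF \<tau> xE] projections_same[OF \<rho> j x] by simp
        also have "\<dots> = (\<Sum>i\<in>I. \<rho> j (\<tau> i x))"
          by (rule endo_sum_arg[OF projections_endo[OF \<rho> j]])
            (use projections_endo[OF \<tau>] endo_closed xE in blast)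
        also have "\<dots> = 0"
        proof (intro sum.neutral ballI)
          fix i assume "i \<in> I"
          then show "\<rho> j (\<tau> i x) = 0"
            using notin \<sigma>(2) by (intro projections_other[OF \<rho> j _ _ *]) auto
        qed
        finally show ?thesis .
      qed
      moreover have "0 \<in> F j"
        using projections_mem[OF \<rho> j E_zero] endo_0[OF projections_endo[OF \<rho> j]] by simp
      ultimately show False using F[OF j] by blast
    qed
  qed
  with \<sigma> show ?thesis by (intro that[of \<sigma>]) (auto simp: bij_betw_def)
qed

end

theorem theorem24:
  fixes scale :: "complex fps \<Rightarrow> 'e::ab_group_add \<Rightarrow> 'e"
    and E :: "'e set" and a :: "'e \<Rightarrow> 'e"
    and m n :: nat and Es Fs :: "nat \<Rightarrow> 'e set"
  assumes "ab_module scale E a" and "regular scale E a"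
    and "\<And>i. i \<in> {1..m} \<Longrightarrow> sub_ab_module scale E a (Es i)"
    and "\<And>i. i \<in> {1..m} \<Longrightarrow> Es i \<noteq> {0} \<and> indecomposable scale (Es i) a"
    and "direct_sum E {1..m} Es"
    and "\<And>i. i \<in> {1..n} \<Longrightarrow> sub_ab_module scale E a (Fs i)"
    and "\<And>i. i \<in> {1..n} \<Longrightarrow> Fs i \<noteq> {0} \<and> indecomposable scale (Fs i) a"
    and "direct_sum E {1..n} Fs"
  shows "m = n \<and>
    (\<exists>\<sigma>. bij_betw \<sigma> {1..n} {1..n} \<and>
      (\<forall>i\<in>{1..n}. ab_isomorphic scale (Es i) a scale (Fs (\<sigma> i)) a))"
proof -
  interpret ab_module scale E a by fact
  obtain \<pi> where \<pi>: "projections {1..m} Es \<pi>"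
    using direct_sum_projections[OF _ assms(3,5)] by blast
  obtain \<rho> where \<rho>: "projections {1..n} Fs \<rho>"
    using direct_sum_projections[OF _ assms(6,8)] by blast
  obtain \<sigma> where \<sigma>: "bij_betw \<sigma> {1..m} {1..n}"
    "\<And>i. i \<in> {1..m} \<Longrightarrow> ab_isomorphic scale (Es i) a scale (Fs (\<sigma> i)) a"
    using krull_schmidt[OF \<pi> \<rho> assms(4,7)] by blast
  have "m = n" using bij_betw_same_card[OF \<sigma>(1)] by simp
  with \<sigma> show ?thesis by blast
qed

end
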